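(* There are continuum-many ($2^{\aleph_0}$) normal monomodal logics $L$ with $K5_2\subseteq L\subseteq K5$.
   Context: Monomodal formulas are built from countably many atoms using $\top,\neg,\vee,\Diamond$, with $\Box\varphi=\neg\Diamond\neg\varphi$. A normal modal logic is a set of formulas containing all propositional tautologies, $\Box(p\to q)\to(\Box p\to\Box q)$ and $\Diamond p\leftrightarrow\neg\Box\neg p$, closed under modus ponens, generalisation and uniform substitution. $K5_2$ is the smallest normal modal logic containing $\Diamond\Diamond p\to\Box\Diamond p$; $K5$ is the smallest normal modal logic containing $\Diamond p\to\Box\Diamond p$. *)

theory Defs
  imports Main "HOL-Library.Equipollence"
begin

datatype fm =
    Atom nat
  | Top    ("\<^bold>\<top>")
  | Neg fm ("\<^bold>\<not> _" [70] 70)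
  | Or fm fm (infixr "\<^bold>\<or>" 50)
  | Dia fm ("\<^bold>\<diamond> _" [70] 70)

abbreviation And :: "fm \<Rightarrow> fm \<Rightarrow> fm" (infixr "\<^bold>\<and>" 55) where
  "\<phi> \<^bold>\<and> \<psi> \<equiv> \<^bold>\<not> (\<^bold>\<not> \<phi> \<^bold>\<or> \<^bold>\<not> \<psi>)"

abbreviation Imp :: "fm \<Rightarrow> fm \<Rightarrow> fm" (infixr "\<^bold>\<rightarrow>" 45) where
  "\<phi> \<^bold>\<rightarrow> \<psi> \<equiv> \<^bold>\<not> \<phi> \<^bold>\<or> \<psi>"

abbreviation Iff :: "fm \<Rightarrow> fm \<Rightarrow> fm" (infix "\<^bold>\<leftrightarrow>" 44) where
  "\<phi> \<^bold>\<leftrightarrow> \<psi> \<equiv> (\<phi> \<^bold>\<rightarrow> \<psi>) \<^bold>\<and> (\<psi> \<^bold>\<rightarrow> \<phi>)"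

abbreviation Box :: "fm \<Rightarrow> fm" ("\<^bold>\<box> _" [70] 70) where
  "\<^bold>\<box> \<phi> \<equiv> \<^bold>\<not> \<^bold>\<diamond> \<^bold>\<not> \<phi>"

text \<open>Propositional evaluation: \<open>v\<close> assigns truth values to the atoms, \<open>d\<close> assigns
  to each \<open>\<phi>\<close> the truth value of \<open>\<^bold>\<diamond> \<phi>\<close>, which is thus treated as a further
  propositional variable.\<close>

primrec beval :: "(nat \<Rightarrow> bool) \<Rightarrow> (fm \<Rightarrow> bool) \<Rightarrow> fm \<Rightarrow> bool" where
  "beval v d (Atom n) \<longleftrightarrow> v n"
| "beval v d \<^bold>\<top> \<longleftrightarrow> True"
| "beval v d (\<^bold>\<not> \<phi>) \<longleftrightarrow> \<not> beval v d \<phi>"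
| "beval v d (\<phi> \<^bold>\<or> \<psi>) \<longleftrightarrow> beval v d \<phi> \<or> beval v d \<psi>"
| "beval v d (\<^bold>\<diamond> \<phi>) \<longleftrightarrow> d \<phi>"

definition tautology :: "fm \<Rightarrow> bool" where
  "tautology \<phi> \<longleftrightarrow> (\<forall>v d. beval v d \<phi>)"

primrec subst :: "(nat \<Rightarrow> fm) \<Rightarrow> fm \<Rightarrow> fm" where
  "subst \<sigma> (Atom n) = \<sigma> n"
| "subst \<sigma> \<^bold>\<top> = \<^bold>\<top>"
| "subst \<sigma> (\<^bold>\<not> \<phi>) = \<^bold>\<not> subst \<sigma> \<phi>"
| "subst \<sigma> (\<phi> \<^bold>\<or> \<psi>) = (subst \<sigma> \<phi> \<^bold>\<or> subst \<sigma> \<psi>)"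
| "subst \<sigma> (\<^bold>\<diamond> \<phi>) = \<^bold>\<diamond> subst \<sigma> \<phi>"

abbreviation p\<^sub>0 :: fm where "p\<^sub>0 \<equiv> Atom 0"
abbreviation p\<^sub>1 :: fm where "p\<^sub>1 \<equiv> Atom 1"

definition normal_logic :: "fm set \<Rightarrow> bool" where
  "normal_logic L \<longleftrightarrow>
     (\<forall>\<phi>. tautology \<phi> \<longrightarrow> \<phi> \<in> L) \<and>
     (\<^bold>\<box> (p\<^sub>0 \<^bold>\<rightarrow> p\<^sub>1) \<^bold>\<rightarrow> (\<^bold>\<box> p\<^sub>0 \<^bold>\<rightarrow> \<^bold>\<box> p\<^sub>1)) \<in> L \<and>
     (\<^bold>\<diamond> p\<^sub>0 \<^bold>\<leftrightarrow> \<^bold>\<not> \<^bold>\<box> \<^bold>\<not> p\<^sub>0) \<in> L \<and>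
     (\<forall>\<phi> \<psi>. (\<phi> \<^bold>\<rightarrow> \<psi>) \<in> L \<longrightarrow> \<phi> \<in> L \<longrightarrow> \<psi> \<in> L) \<and>
     (\<forall>\<phi>. \<phi> \<in> L \<longrightarrow> \<^bold>\<box> \<phi> \<in> L) \<and>
     (\<forall>\<sigma> \<phi>. \<phi> \<in> L \<longrightarrow> subst \<sigma> \<phi> \<in> L)"

definition smallest_normal_logic :: "fm \<Rightarrow> fm set" where
  "smallest_normal_logic \<chi> = \<Inter> {L. normal_logic L \<and> \<chi> \<in> L}"

definition K5 :: "fm set" where
  "K5 = smallest_normal_logic (\<^bold>\<diamond> p\<^sub>0 \<^bold>\<rightarrow> \<^bold>\<box> \<^bold>\<diamond> p\<^sub>0)"

definition K5_2 :: "fm set" where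
  "K5_2 = smallest_normal_logic (\<^bold>\<diamond> \<^bold>\<diamond> p\<^sub>0 \<^bold>\<rightarrow> \<^bold>\<box> \<^bold>\<diamond> p\<^sub>0)"

lemma normal_logic_smallest: "normal_logic (smallest_normal_logic \<chi>)"
  unfolding smallest_normal_logic_def normal_logic_def by blast

lemma smallest_normal_logic_mem: "\<chi> \<in> smallest_normal_logic \<chi>"
  unfolding smallest_normal_logic_def by blast

lemma smallest_normal_logic_least:
  "normal_logic L \<Longrightarrow> \<chi> \<in> L \<Longrightarrow> smallest_normal_logic \<chi> \<subseteq> L"
  unfolding smallest_normal_logic_def by blast

end

theory Submission imports Defs "HOL-Library.Countable" begin

text \<open>Since there are only countably many formulas, there are at most continuum-many logics.
  For the lower bound, observe that the frame condition expressed by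
  \<open>\<^bold>\<diamond> \<^bold>\<diamond> p \<^bold>\<rightarrow> \<^bold>\<box> \<^bold>\<diamond> p\<close> makes all points at the same distance from a root share their
  successors. A sequence of disjoint layers, each point seeing exactly the next layer,
  therefore satisfies it whatever the sizes of the layers are. A formula can only inspect a window
  of consecutive layers, and contiguous windows, unlike scattered subsequences, admit infinite
  antichains: with sizes 1 and 2, the patterns \<open>2 1\<^sup>n 2\<close> form one.

  Let \<open>R\<^sub>n\<close> be the layered frame in which precisely the layers \<open>1\<close> and \<open>n + 2\<close> have two
  elements. The formula \<open>\<chi>\<^sub>n\<close> says that if both the next layer and the one \<open>n + 2\<close> steps away
  can be split by an atom, then \<open>\<^bold>\<diamond> p \<^bold>\<rightarrow> \<^bold>\<box> \<^bold>\<diamond> p\<close>. It belongs to \<open>K5\<close> because of its conclusion,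
  it fails at the root of \<open>R\<^sub>n\<close>, and it is valid in \<open>R\<^sub>m\<close> for \<open>m \<noteq> n\<close> because there its
  premise is never satisfied. The logics \<open>K5 \<inter> (\<Inter>n\<in>A. Log R\<^sub>n)\<close> lie in the interval by
  construction and are separated by the formulas \<open>\<chi>\<^sub>n\<close>, so distinct sets \<open>A\<close> yield distinct
  logics. Keeping \<open>K5\<close> as one of the intersected logics avoids any
  completeness theorem for it.\<close>

section \<open>Logics of frames\<close>

primrec sat :: "('w \<Rightarrow> 'w \<Rightarrow> bool) \<Rightarrow> (nat \<Rightarrow> 'w \<Rightarrow> bool) \<Rightarrow> 'w \<Rightarrow> fm \<Rightarrow> bool" where
  "sat R V w (Atom n) \<longleftrightarrow> V n w"
| "sat R V w \<^bold>\<top> \<longleftrightarrow> True"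
| "sat R V w (\<^bold>\<not> \<phi>) \<longleftrightarrow> \<not> sat R V w \<phi>"
| "sat R V w (\<phi> \<^bold>\<or> \<psi>) \<longleftrightarrow> sat R V w \<phi> \<or> sat R V w \<psi>"
| "sat R V w (\<^bold>\<diamond> \<phi>) \<longleftrightarrow> (\<exists>u. R w u \<and> sat R V u \<phi>)"

definition frame_logic :: "('w \<Rightarrow> 'w \<Rightarrow> bool) \<Rightarrow> fm set" where
  "frame_logic R = {\<phi>. \<forall>V w. sat R V w \<phi>}"

lemma sat_beval: "sat R V w \<phi> \<longleftrightarrow> beval (\<lambda>n. V n w) (\<lambda>\<psi>. sat R V w (\<^bold>\<diamond> \<psi>)) \<phi>"
  by (induction \<phi>) auto

lemma sat_subst: "sat R V w (subst \<sigma> \<phi>) \<longleftrightarrow> sat R (\<lambda>n u. sat R V u (\<sigma> n)) w \<phi>"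
  by (induction \<phi> arbitrary: w) auto

lemma sat_tautology:
  assumes "tautology \<phi>"
  shows "sat R V w \<phi>"
  using assms by (subst sat_beval) (simp add: tautology_def)

lemma normal_logic_frame_logic: "normal_logic (frame_logic R)"
  unfolding normal_logic_def
proof (intro conjI allI impI)
  fix \<phi> assume "tautology \<phi>"
  then show "\<phi> \<in> frame_logic R"
    by (simp add: frame_logic_def sat_tautology)
next
  fix \<sigma> \<phi> assume "\<phi> \<in> frame_logic R"
  then show "subst \<sigma> \<phi> \<in> frame_logic R"
    by (simp add: frame_logic_def sat_subst)
qed (auto simp: frame_logic_def)

lemma normal_logic_Inter:
  assumes "\<And>L. L \<in> \<L> \<Longrightarrow> normal_logic L"
  shows "normal_logic (\<Inter>\<L>)"
  using assms unfolding normal_logic_def by blast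

section \<open>The lower end of the interval\<close>

lemma normal_logic_tautology: "normal_logic L \<Longrightarrow> tautology \<phi> \<Longrightarrow> \<phi> \<in> L"
  unfolding normal_logic_def by blast

lemma normal_logic_mp: "normal_logic L \<Longrightarrow> (\<phi> \<^bold>\<rightarrow> \<psi>) \<in> L \<Longrightarrow> \<phi> \<in> L \<Longrightarrow> \<psi> \<in> L"
  unfolding normal_logic_def by blast

lemma normal_logic_subst: "normal_logic L \<Longrightarrow> \<phi> \<in> L \<Longrightarrow> subst \<sigma> \<phi> \<in> L"
  unfolding normal_logic_def by blast

lemma normal_logic_imp_trans:
  assumes "normal_logic L" "(\<phi> \<^bold>\<rightarrow> \<psi>) \<in> L" "(\<psi> \<^bold>\<rightarrow> \<theta>) \<in> L"
  shows "(\<phi> \<^bold>\<rightarrow> \<theta>) \<in> L"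
proof -
  have "tautology ((\<phi> \<^bold>\<rightarrow> \<psi>) \<^bold>\<rightarrow> ((\<psi> \<^bold>\<rightarrow> \<theta>) \<^bold>\<rightarrow> (\<phi> \<^bold>\<rightarrow> \<theta>)))"
    by (auto simp: tautology_def)
  then have "((\<phi> \<^bold>\<rightarrow> \<psi>) \<^bold>\<rightarrow> ((\<psi> \<^bold>\<rightarrow> \<theta>) \<^bold>\<rightarrow> (\<phi> \<^bold>\<rightarrow> \<theta>))) \<in> L"
    by (rule normal_logic_tautology[OF assms(1)])
  then show ?thesis
    using assms normal_logic_mp by metis
qed

lemma normal_logic_dia_mono:
  assumes L: "normal_logic L" and "(\<phi> \<^bold>\<rightarrow> \<psi>) \<in> L"
  shows "(\<^bold>\<diamond> \<phi> \<^bold>\<rightarrow> \<^bold>\<diamond> \<psi>) \<in> L"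
proof -
  note taut = normal_logic_tautology[OF L] and mp = normal_logic_mp[OF L]
    and sub = normal_logic_subst[OF L]
  have "tautology ((\<phi> \<^bold>\<rightarrow> \<psi>) \<^bold>\<rightarrow> (\<^bold>\<not> \<psi> \<^bold>\<rightarrow> \<^bold>\<not> \<phi>))"
    by (auto simp: tautology_def)
  then have "(\<^bold>\<not> \<psi> \<^bold>\<rightarrow> \<^bold>\<not> \<phi>) \<in> L"
    using assms(2) taut mp by blast
  then have box: "(\<^bold>\<box> (\<^bold>\<not> \<psi> \<^bold>\<rightarrow> \<^bold>\<not> \<phi>)) \<in> L"
    using L unfolding normal_logic_def by blast
  have "(\<^bold>\<box> (p\<^sub>0 \<^bold>\<rightarrow> p\<^sub>1) \<^bold>\<rightarrow> (\<^bold>\<box> p\<^sub>0 \<^bold>\<rightarrow> \<^bold>\<box> p\<^sub>1)) \<in> L"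
    using L unfolding normal_logic_def by blast
  from sub[OF this, of "\<lambda>n. if n = 0 then \<^bold>\<not> \<psi> else \<^bold>\<not> \<phi>"]
  have "(\<^bold>\<box> (\<^bold>\<not> \<psi> \<^bold>\<rightarrow> \<^bold>\<not> \<phi>) \<^bold>\<rightarrow> (\<^bold>\<box> \<^bold>\<not> \<psi> \<^bold>\<rightarrow> \<^bold>\<box> \<^bold>\<not> \<phi>)) \<in> L"
    by simp
  then have boxes: "(\<^bold>\<box> \<^bold>\<not> \<psi> \<^bold>\<rightarrow> \<^bold>\<box> \<^bold>\<not> \<phi>) \<in> L"
    using box mp by blast
  \<comment> \<open>\<open>\<^bold>\<box> \<^bold>\<not> \<theta>\<close> abbreviates \<open>\<^bold>\<not> \<^bold>\<diamond> \<^bold>\<not> \<^bold>\<not> \<theta>\<close>, so the duality axiom is what removes the double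
    negation under the diamond.\<close>
  have "(\<^bold>\<diamond> p\<^sub>0 \<^bold>\<leftrightarrow> \<^bold>\<not> \<^bold>\<box> \<^bold>\<not> p\<^sub>0) \<in> L"
    using L unfolding normal_logic_def by blast
  from sub[OF this, of "\<lambda>_. \<theta>" for \<theta>]
  have dual: "(\<^bold>\<diamond> \<theta> \<^bold>\<leftrightarrow> \<^bold>\<not> \<^bold>\<box> \<^bold>\<not> \<theta>) \<in> L" for \<theta>
    by simp
  have "tautology ((\<^bold>\<box> \<^bold>\<not> \<psi> \<^bold>\<rightarrow> \<^bold>\<box> \<^bold>\<not> \<phi>) \<^bold>\<rightarrow> ((\<^bold>\<diamond> \<phi> \<^bold>\<leftrightarrow> \<^bold>\<not> \<^bold>\<box> \<^bold>\<not> \<phi>) \<^bold>\<rightarrow>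
      ((\<^bold>\<diamond> \<psi> \<^bold>\<leftrightarrow> \<^bold>\<not> \<^bold>\<box> \<^bold>\<not> \<psi>) \<^bold>\<rightarrow> (\<^bold>\<diamond> \<phi> \<^bold>\<rightarrow> \<^bold>\<diamond> \<psi>))))"
    by (auto simp: tautology_def)
  then show ?thesis
    using boxes dual taut mp by blast
qed

text \<open>The implication \<open>\<^bold>\<diamond> \<^bold>\<diamond> p \<^bold>\<rightarrow> \<^bold>\<diamond> p\<close> is not available in \<open>K5\<close>. Instead,
  \<open>\<^bold>\<diamond> \<^bold>\<diamond> p \<^bold>\<rightarrow> \<^bold>\<diamond> \<^bold>\<box> \<^bold>\<diamond> p \<^bold>\<rightarrow> \<^bold>\<box> \<^bold>\<diamond> p\<close>: the first step is the axiom under a diamond, the second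
  the contrapositive of its instance for \<open>\<^bold>\<not> \<^bold>\<diamond> p\<close>.\<close>

lemma K5_2_subset_K5: "K5_2 \<subseteq> K5"
proof -
  have L: "normal_logic K5"
    by (simp add: K5_def normal_logic_smallest)
  have ax: "(\<^bold>\<diamond> p\<^sub>0 \<^bold>\<rightarrow> \<^bold>\<box> \<^bold>\<diamond> p\<^sub>0) \<in> K5"
    by (simp add: K5_def smallest_normal_logic_mem)
  then have "subst (\<lambda>_. \<^bold>\<not> \<^bold>\<diamond> p\<^sub>0) (\<^bold>\<diamond> p\<^sub>0 \<^bold>\<rightarrow> \<^bold>\<box> \<^bold>\<diamond> p\<^sub>0) \<in> K5"
    using L unfolding normal_logic_def by blast
  then have "(\<^bold>\<diamond> \<^bold>\<not> \<^bold>\<diamond> p\<^sub>0 \<^bold>\<rightarrow> \<^bold>\<box> \<^bold>\<diamond> \<^bold>\<not> \<^bold>\<diamond> p\<^sub>0) \<in> K5"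
    by simp
  moreover have "tautology ((\<^bold>\<diamond> \<^bold>\<not> \<^bold>\<diamond> p\<^sub>0 \<^bold>\<rightarrow> \<^bold>\<box> \<^bold>\<diamond> \<^bold>\<not> \<^bold>\<diamond> p\<^sub>0) \<^bold>\<rightarrow> (\<^bold>\<diamond> \<^bold>\<box> \<^bold>\<diamond> p\<^sub>0 \<^bold>\<rightarrow> \<^bold>\<box> \<^bold>\<diamond> p\<^sub>0))"
    by (auto simp: tautology_def)
  ultimately have "(\<^bold>\<diamond> \<^bold>\<box> \<^bold>\<diamond> p\<^sub>0 \<^bold>\<rightarrow> \<^bold>\<box> \<^bold>\<diamond> p\<^sub>0) \<in> K5"
    using L unfolding normal_logic_def by blast
  with normal_logic_dia_mono[OF L ax] have "(\<^bold>\<diamond> \<^bold>\<diamond> p\<^sub>0 \<^bold>\<rightarrow> \<^bold>\<box> \<^bold>\<diamond> p\<^sub>0) \<in> K5"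
    by (rule normal_logic_imp_trans[OF L])
  then show ?thesis
    unfolding K5_2_def by (rule smallest_normal_logic_least[OF L])
qed

lemma K5_2_subset_frame_logic:
  assumes "\<And>x y z u. R x y \<Longrightarrow> R y z \<Longrightarrow> R x u \<Longrightarrow> R u z"
  shows "K5_2 \<subseteq> frame_logic R"
  unfolding K5_2_def
proof (rule smallest_normal_logic_least[OF normal_logic_frame_logic])
  show "(\<^bold>\<diamond> \<^bold>\<diamond> p\<^sub>0 \<^bold>\<rightarrow> \<^bold>\<box> \<^bold>\<diamond> p\<^sub>0) \<in> frame_logic R"
    unfolding frame_logic_def by simp (use assms in blast)
qed

section \<open>An antichain of layered frames\<close>

text \<open>The pair \<open>(i, b)\<close> is an element of layer \<open>i\<close>. Pairs \<open>(i, True)\<close> outside the layers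
  \<open>1\<close> and \<open>n + 2\<close> have no predecessors; they are harmless additional roots, kept so
  that the whole type can serve as the set of worlds.\<close>

definition layered :: "nat \<Rightarrow> nat \<times> bool \<Rightarrow> nat \<times> bool \<Rightarrow> bool" where
  "layered n w u \<longleftrightarrow> fst u = Suc (fst w) \<and> (snd u \<longrightarrow> fst u \<in> {1, n + 2})"

definition split_fm :: "nat \<Rightarrow> nat \<Rightarrow> fm" where
  "split_fm k a = ((Dia ^^ k) (Atom a) \<^bold>\<and> (Dia ^^ k) (\<^bold>\<not> Atom a))"

text \<open>With the premise \<open>split_fm 1 0\<close>, which says that \<open>p\<close> distinguishes two successors, the
  conclusion fails at the root of \<^term>\<open>layered n\<close> as soon as layer \<open>2\<close> avoids \<open>p\<close>. A separate
  atom splits the distant layer, since for \<open>n = 0\<close> that layer is layer \<open>2\<close> itself.\<close>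

definition chi :: "nat \<Rightarrow> fm" where
  "chi n = (split_fm 1 0 \<^bold>\<and> split_fm (n + 2) 1 \<^bold>\<rightarrow> (\<^bold>\<diamond> p\<^sub>0 \<^bold>\<rightarrow> \<^bold>\<box> \<^bold>\<diamond> p\<^sub>0))"

lemma sat_layered_dia_Suc:
  "sat (layered n) V w ((Dia ^^ Suc k) \<phi>) \<longleftrightarrow>
    (\<exists>u. fst u = fst w + Suc k \<and> (snd u \<longrightarrow> fst u \<in> {1, n + 2}) \<and> sat (layered n) V u \<phi>)"
proof (induction k arbitrary: w)
  case 0
  then show ?case by (auto simp: layered_def)
next
  case (Suc k)
  have Suc_level: "fst u + Suc k = fst w + Suc (Suc k)" if "layered n w u" for u
    using that by (simp add: layered_def)
  have serial: "\<exists>u. layered n w u"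
    by (rule exI[of _ "(Suc (fst w), False)"]) (simp add: layered_def)
  have "sat (layered n) V w ((Dia ^^ Suc (Suc k)) \<phi>) \<longleftrightarrow>
      (\<exists>u. layered n w u \<and> sat (layered n) V u ((Dia ^^ Suc k) \<phi>))"
    by simp
  also have "\<dots> \<longleftrightarrow> (\<exists>v. layered n w v) \<and> (\<exists>u. fst u = fst w + Suc (Suc k) \<and>
      (snd u \<longrightarrow> fst u \<in> {1, n + 2}) \<and> sat (layered n) V u \<phi>)"
    unfolding Suc.IH using Suc_level by metis
  finally show ?case using serial by blast
qed

lemma sat_split_fm_layered:
  assumes "sat (layered n) V w (split_fm (Suc k) a)"
  shows "fst w + Suc k \<in> {1, n + 2}"
proof -
  obtain u v where u: "fst u = fst w + Suc k" "snd u \<longrightarrow> fst u \<in> {1, n + 2}" "V a u"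
    and v: "fst v = fst w + Suc k" "snd v \<longrightarrow> fst v \<in> {1, n + 2}" "\<not> V a v"
    using assms unfolding split_fm_def sat.simps sat_layered_dia_Suc by auto
  then have "u \<noteq> v" by auto
  with u v have "snd u \<or> snd v"
    by (auto simp: prod_eq_iff)
  with u v show ?thesis by auto
qed

lemma chi_in_frame_logic_layered:
  assumes "m \<noteq> n"
  shows "chi n \<in> frame_logic (layered m)"
proof -
  have "\<not> (sat (layered m) V w (split_fm 1 0) \<and> sat (layered m) V w (split_fm (n + 2) 1))" for V w
  proof
    assume *: "sat (layered m) V w (split_fm 1 0) \<and> sat (layered m) V w (split_fm (n + 2) 1)"
    have "fst w + 1 \<in> {1, m + 2}" "fst w + (n + 2) \<in> {1, m + 2}"
      using * sat_split_fm_layered[of m V w 0 0] sat_split_fm_layered[of m V w "Suc n" 1]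
      by auto
    with assms show False by auto
  qed
  then show ?thesis
    by (auto simp: frame_logic_def chi_def)
qed

lemma chi_notin_frame_logic_layered: "chi n \<notin> frame_logic (layered n)"
proof -
  define V :: "nat \<Rightarrow> nat \<times> bool \<Rightarrow> bool" where
    "V = (\<lambda>a w. if a = 0 then w = (1, True) else snd w)"
  let ?w = "(0, False) :: nat \<times> bool"
  have "sat (layered n) V ?w (split_fm 1 0)"
    unfolding split_fm_def One_nat_def sat.simps sat_layered_dia_Suc
    by (auto simp: V_def)
  moreover have "sat (layered n) V ?w (split_fm (n + 2) 1)"
    unfolding split_fm_def add_2_eq_Suc' sat.simps sat_layered_dia_Suc
    by (auto simp: V_def)
  moreover have "sat (layered n) V ?w (\<^bold>\<diamond> p\<^sub>0)"
    by (auto simp: V_def layered_def)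
  moreover have "\<not> sat (layered n) V ?w (\<^bold>\<box> \<^bold>\<diamond> p\<^sub>0)"
    by (auto simp: V_def layered_def)
  ultimately show ?thesis
    unfolding frame_logic_def chi_def by (auto simp del: sat.simps(5))
qed

lemma chi_in_K5: "chi n \<in> K5"
proof -
  have L: "normal_logic K5"
    by (simp add: K5_def normal_logic_smallest)
  have ax: "(\<^bold>\<diamond> p\<^sub>0 \<^bold>\<rightarrow> \<^bold>\<box> \<^bold>\<diamond> p\<^sub>0) \<in> K5"
    by (simp add: K5_def smallest_normal_logic_mem)
  have "tautology ((\<^bold>\<diamond> p\<^sub>0 \<^bold>\<rightarrow> \<^bold>\<box> \<^bold>\<diamond> p\<^sub>0) \<^bold>\<rightarrow> chi n)"
    by (auto simp: tautology_def chi_def)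
  with L ax show ?thesis
    unfolding normal_logic_def by blast
qed

section \<open>Counting the interval\<close>

definition layered_logic :: "nat set \<Rightarrow> fm set" where
  "layered_logic A = \<Inter> (insert K5 ((\<lambda>n. frame_logic (layered n)) ` A))"

lemma chi_in_layered_logic_iff: "chi n \<in> layered_logic A \<longleftrightarrow> n \<notin> A"
proof -
  have "chi n \<in> frame_logic (layered m) \<longleftrightarrow> m \<noteq> n" for m
    using chi_in_frame_logic_layered chi_notin_frame_logic_layered by blast
  then show ?thesis
    by (auto simp: layered_logic_def chi_in_K5)
qed

lemma layered_logic_in_interval:
  "normal_logic (layered_logic A)" "K5_2 \<subseteq> layered_logic A" "layered_logic A \<subseteq> K5"
proof -
  show "normal_logic (layered_logic A)"
    unfolding layered_logic_def
    by (rule normal_logic_Inter)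
      (auto simp: normal_logic_frame_logic K5_def normal_logic_smallest)
  have "K5_2 \<subseteq> frame_logic (layered n)" for n
    by (rule K5_2_subset_frame_logic) (auto simp: layered_def)
  then show "K5_2 \<subseteq> layered_logic A"
    using K5_2_subset_K5 unfolding layered_logic_def by blast
  show "layered_logic A \<subseteq> K5"
    unfolding layered_logic_def by blast
qed

instance fm :: countable
  by countable_datatype

theorem mainTheorem5:
  "{L. normal_logic L \<and> K5_2 \<subseteq> L \<and> L \<subseteq> K5} \<approx> (UNIV :: nat set set)"
proof (rule lepoll_antisym)
  have "inj (\<lambda>L :: fm set. to_nat ` L)"
    by (rule injI) (simp add: inj_image_eq_iff)
  then show "{L. normal_logic L \<and> K5_2 \<subseteq> L \<and> L \<subseteq> K5} \<lesssim> (UNIV :: nat set set)"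
    unfolding lepoll_def by (meson inj_on_subset subset_UNIV)
  have "inj layered_logic"
    by (rule injI) (use chi_in_layered_logic_iff in blast)
  then show "(UNIV :: nat set set) \<lesssim> {L. normal_logic L \<and> K5_2 \<subseteq> L \<and> L \<subseteq> K5}"
    unfolding lepoll_def using layered_logic_in_interval by blast
qed

end
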